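(* Let $(E,\mathcal D,\mathcal J)$ be a symplectic Banach triple. Let $H\in C^1(E,\mathbb R)\cap \mathrm{Dif}(\mathcal D,\mathcal J)$ and suppose $H$ has a Hamiltonian flow $\Phi_t^H$. Let $G$ be a Lie group with Lie algebra $\mathfrak g$, and let $\Phi$ be a globally Hamiltonian action of $G$ on $E$ with $\mathrm{Ad}^*$-equivariant momentum map $F:E\to\mathbb R^m\simeq\mathfrak g^*$. Suppose that $H\circ\Phi_g=H$ for all $g\in G$. (i) Then $G$ is an invariance group for $\Phi_t^H$, i.e. $\Phi_g\circ\Phi_t^H=\Phi_t^H\circ\Phi_g$ for all $g\in G$, $t\in\mathbb R$. (ii) Let $u\in E$ and let $\mu=F(u)\in\mathbb R^m\simeq\mathfrak g^*$. Consider the following statements: (1) $u$ is a relative $G$-equilibrium. (2) $u$ is a relative $G_\mu$-equilibrium. (3) There exists $\xi\in\mathfrak g_\mu$ such that, for all $t\in\mathbb R$, $\Phi_t^H(u)=\Phi_{\exp(t\xi)}(u)$. (4) There exists $\xi\in\mathfrak g_\mu$ such that $D_uH-\xi\cdot D_uF=0$. (5) There exists $\xi\in\mathfrak g$ such that $D_uH-\xi\cdot D_uF=0$. Then (1) $\Leftrightarrow$ (2) $\Leftarrow$ (3). If $u\in\mathcal D$, then (1) $\Leftrightarrow$ (2) $\Leftarrow$ (3) $\Leftrightarrow$ (4) $\Leftrightarrow$ (5). If in addition $\mu$ is a regular value of $F$, then (1) $\Leftrightarrow$ (2) $\Leftarrow$ (3) $\Leftrightarrow$ (4) $\Leftrightarrow$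 (5) $\Leftrightarrow$ (6), where (6) is the statement: (6) $u$ is a critical point of $H_\mu$ on $\Sigma_\mu$, where $H_\mu=H|_{\Sigma_\mu}$. In addition, $\xi$ is then unique.
   Context: Symplectic Banach triple $(E,\mathcal D,\mathcal J)$: $E$ is a real Banach space; $\mathcal D\subset E$ is a dense subset (a "domain"); $\mathcal J:E\to E^*$ is a symplector, i.e. a continuous injective linear map with $(\mathcal Ju)(v)=-(\mathcal Jv)(u)$ for all $u,v\in E$. Its range is denoted $\mathcal R_{\mathcal J}\subset E^*$. $\mathrm{Dif}(\mathcal D,\mathcal J)$ is the set of functions $F:E\to\mathbb R$ that are Fréchet differentiable (with respect to the norm of $E$) at every $u\in\mathcal D$, with $D_uF\in\mathcal R_{\mathcal J}$ for all $u\in\mathcal D$. A Hamiltonian flow for $F\in\mathrm{Dif}(\mathcal D,\mathcal J)$ is a separately continuous map $\Phi^F:\mathbb R\times E\to E$, $(t,u)\mapsto\Phi^F_t(u)$, such that: $\Phi^F_{t+s}=\Phi^F_t\circ\Phi^F_s$ and $\Phi^F_0=\mathrm{Id}$; $\Phi^F_t(\mathcal D)=\mathcal D$ for all $t$; and for all $u\in\mathcal D$ the curve $t\mapsto u(t)=\Phi^F_t(u)\in\mathcal D\subset E$ is differentiable (in $E$) and is the unique solution of $\mathcal J\dot u(t)=D_{u(t)}F$, $u(0)=u$. A map $\Phi\in C^0(E,E)\cap C^1(\mathcal D,E)$ is symplectic if $(\mathcal JD_u\Phi(v))(D_u\Phi(w))=(\mathcal Jv)(w)$ for all $u\in\mathcal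 D$, $v,w\in E$. Actions of a (topological) group on $E$ are separately continuous. A Lie group is understood as a matrix Lie group. An action $\Phi$ of a Lie group $G$ (Lie algebra $\mathfrak g$, $\dim\mathfrak g=m$) on $E$ is globally Hamiltonian if: every $\Phi_g\in C^1(E,E)$ is symplectic; $\Phi_g(\mathcal D)=\mathcal D$ for all $g\in G$; and for each $\xi\in\mathfrak g$ there is $F_\xi\in C^1(E,\mathbb R)\cap\mathrm{Dif}(\mathcal D,\mathcal J)$ with $\Phi_{\exp(t\xi)}=\Phi_t^{F_\xi}$ for all $t$, with $\xi\mapsto F_\xi$ linear. Choosing a basis $e_1,\dots,e_m$ of $\mathfrak g$, one identifies $\mathfrak g\simeq\mathbb R^m$ and (by the dual basis) $\mathfrak g^*\simeq\mathbb R^m$; the momentum map is $F=(F_{e_1},\dots,F_{e_m}):E\to\mathbb R^m$, and $F_\xi=\xi\cdot F$. It is $\mathrm{Ad}^*$-equivariant if $F\circ\Phi_g=\mathrm{Ad}^*_gF$ for all $g\in G$, where $(\mathrm{Ad}^*_g\mu)(\xi)=\mu(\mathrm{Ad}_{g^{-1}}\xi)$. For $\mu\in\mathfrak g^*$: $G_\mu=\{g\in G\mid\mathrm{Ad}^*_g\mu=\mu\}$, with Lie algebra $\mathfrak g_\mu$; $\Sigma_\mu=\{u\in E\mid F(u)=\mu\}$. The value $\mu$ is a regular value of $F$ if $\Sigma_\mu\ne\emptyset$ and $D_uF:E\to\mathbb R^m$ is surjective for all $u\in\Sigma_\mu$; then $\Sigma_\mu$ is a codimension $m$ submanifold with $T_u\Sigma_\mu=\ker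 D_uF$, and $u\in\Sigma_\mu$ is a critical point of $H_\mu$ if $D_uH$ vanishes on $T_u\Sigma_\mu$. For a group $\tilde G$ commuting with the flow, $u$ is a relative $\tilde G$-equilibrium if $\Phi_t^H(u)\in\{\Phi_g(u)\mid g\in\tilde G\}$ for all $t\in\mathbb R$. *)

theory Defs
  imports "HOL-Analysis.Analysis"
begin

text \<open>Only meaningful at points where \<open>f\<close> is differentiable.\<close>

definition D_at :: "('a::real_normed_vector \<Rightarrow> 'b::real_normed_vector) \<Rightarrow> 'a \<Rightarrow> 'a \<Rightarrow>\<^sub>L 'b" where
  "D_at f u = Blinfun (frechet_derivative f (at u))"

text \<open>The set \<open>S\<close> need not be open: at each point of \<open>S\<close> the derivative is taken in the whole
  space, and it has to depend continuously (in operator norm) on the point of \<open>S\<close>.\<close>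

definition C1_on :: "'a::real_normed_vector set \<Rightarrow> ('a \<Rightarrow> 'b::real_normed_vector) \<Rightarrow> bool" where
  "C1_on S f \<longleftrightarrow> (\<forall>u\<in>S. f differentiable (at u)) \<and> continuous_on S (D_at f)"

definition symplector :: "('a::banach \<Rightarrow>\<^sub>L ('a \<Rightarrow>\<^sub>L real)) \<Rightarrow> bool" where
  "symplector J \<longleftrightarrow> inj (blinfun_apply J) \<and> (\<forall>u v. J u v = - J v u)"

definition symplectic_banach_triple :: "'a::banach set \<Rightarrow> ('a \<Rightarrow>\<^sub>L ('a \<Rightarrow>\<^sub>L real)) \<Rightarrow> bool" where
  "symplectic_banach_triple D J \<longleftrightarrow> closure D = UNIV \<and> symplector J"

definition Dif :: "'a::banach set \<Rightarrow> ('a \<Rightarrow>\<^sub>L ('a \<Rightarrow>\<^sub>L real)) \<Rightarrow> ('a \<Rightarrow> real) set" where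
  "Dif D J = {F. \<forall>u\<in>D. F differentiable (at u) \<and> D_at F u \<in> range (blinfun_apply J)}"

definition hamiltonian_solution ::
    "'a::banach set \<Rightarrow> ('a \<Rightarrow>\<^sub>L ('a \<Rightarrow>\<^sub>L real)) \<Rightarrow> ('a \<Rightarrow> real) \<Rightarrow> (real \<Rightarrow> 'a) \<Rightarrow> bool" where
  "hamiltonian_solution D J F c \<longleftrightarrow>
     (\<forall>t. c t \<in> D \<and> (\<exists>c'. (c has_vector_derivative c') (at t) \<and> J c' = D_at F (c t)))"

text \<open>Uniqueness is understood among global (defined for all times) differentiable solutions
  with values in the domain.\<close>

definition hamiltonian_flow ::
    "'a::banach set \<Rightarrow> ('a \<Rightarrow>\<^sub>L ('a \<Rightarrow>\<^sub>L real)) \<Rightarrow> ('a \<Rightarrow> real) \<Rightarrow> (real \<Rightarrow> 'a \<Rightarrow> 'a) \<Rightarrow> bool" where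
  "hamiltonian_flow D J F \<phi> \<longleftrightarrow>
     (\<forall>u. continuous_on UNIV (\<lambda>t. \<phi> t u)) \<and>
     (\<forall>t. continuous_on UNIV (\<phi> t)) \<and>
     (\<forall>t s. \<phi> (t + s) = \<phi> t \<circ> \<phi> s) \<and> \<phi> 0 = id \<and>
     (\<forall>t. \<phi> t ` D = D) \<and>
     (\<forall>u\<in>D. hamiltonian_solution D J F (\<lambda>t. \<phi> t u) \<and>
        (\<forall>c. hamiltonian_solution D J F c \<and> c 0 = u \<longrightarrow> c = (\<lambda>t. \<phi> t u)))"

definition symplectic_map ::
    "'a::banach set \<Rightarrow> ('a \<Rightarrow>\<^sub>L ('a \<Rightarrow>\<^sub>L real)) \<Rightarrow> ('a \<Rightarrow> 'a) \<Rightarrow> bool" where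
  "symplectic_map D J f \<longleftrightarrow> continuous_on UNIV f \<and> C1_on D f \<and>
     (\<forall>u\<in>D. \<forall>v w. J (D_at f u v) (D_at f u w) = J v w)"

text \<open>Complex matrices are regarded as a real normed space, so linear independence and span
  below are over the reals. The multiplication is \<open>**\<close>; the type has no multiplication class
  for which the library exponential would be the matrix exponential.\<close>

type_synonym 'n cmat = "complex^'n^'n"

definition mat_power :: "'n::finite cmat \<Rightarrow> nat \<Rightarrow> 'n cmat" where
  "mat_power A k = (((**) A) ^^ k) (mat 1)"

definition mexp :: "'n::finite cmat \<Rightarrow> 'n cmat" where
  "mexp A = (\<Sum>k. (1 / fact k) *\<^sub>R mat_power A k)"

text \<open>Closed subgroups of the general linear group (closed relative to it).\<close>

definition matrix_lie_group :: "'n::finite cmat set \<Rightarrow> bool" where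
  "matrix_lie_group G \<longleftrightarrow>
     closedin (top_of_set {A. invertible A}) G \<and> mat 1 \<in> G \<and>
     (\<forall>A\<in>G. \<forall>B\<in>G. A ** B \<in> G) \<and> (\<forall>A\<in>G. matrix_inv A \<in> G)"

definition lie_algebra :: "'n::finite cmat set \<Rightarrow> 'n cmat set" where
  "lie_algebra G = {X. \<forall>t::real. mexp (t *\<^sub>R X) \<in> G}"

definition Ad :: "'n::finite cmat \<Rightarrow> 'n cmat \<Rightarrow> 'n cmat" where
  "Ad g X = g ** X ** matrix_inv g"

text \<open>A basis \<open>e 0, \<dots>, e (m - 1)\<close> of the Lie algebra; \<open>m = 0\<close> (discrete groups) is
  allowed. Vectors of \<open>\<real>\<^sup>m\<close> are extensional functions in \<open>{..<m} \<rightarrow>\<^sub>E UNIV\<close>.\<close>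

definition lie_basis :: "'n::finite cmat set \<Rightarrow> nat \<Rightarrow> (nat \<Rightarrow> 'n cmat) \<Rightarrow> bool" where
  "lie_basis G m e \<longleftrightarrow> inj_on e {..<m} \<and> independent (e ` {..<m}) \<and> span (e ` {..<m}) = lie_algebra G"

definition coord :: "nat \<Rightarrow> (nat \<Rightarrow> 'n::finite cmat) \<Rightarrow> 'n cmat \<Rightarrow> nat \<Rightarrow> real" where
  "coord m e \<xi> i = representation (e ` {..<m}) \<xi> (e i)"

text \<open>The value at \<open>\<xi>\<close> of the functional with components \<open>\<mu>\<close> in the dual basis.\<close>

definition pairing :: "nat \<Rightarrow> (nat \<Rightarrow> 'n::finite cmat) \<Rightarrow> (nat \<Rightarrow> real) \<Rightarrow> 'n cmat \<Rightarrow> real" where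
  "pairing m e \<mu> \<xi> = (\<Sum>i<m. coord m e \<xi> i * \<mu> i)"

text \<open>Components in the dual basis of the functional
  \<open>\<xi> \<mapsto> \<mu> (Ad (matrix_inv g) \<xi>)\<close>.\<close>

definition Ad_star ::
    "nat \<Rightarrow> (nat \<Rightarrow> 'n::finite cmat) \<Rightarrow> 'n cmat \<Rightarrow> (nat \<Rightarrow> real) \<Rightarrow> (nat \<Rightarrow> real)" where
  "Ad_star m e g \<mu> = (\<lambda>i\<in>{..<m}. pairing m e \<mu> (Ad (matrix_inv g) (e i)))"

definition coadjoint_isotropy ::
    "'n::finite cmat set \<Rightarrow> nat \<Rightarrow> (nat \<Rightarrow> 'n cmat) \<Rightarrow> (nat \<Rightarrow> real) \<Rightarrow> 'n cmat set" where
  "coadjoint_isotropy G m e \<mu> = {g\<in>G. Ad_star m e g \<mu> = \<mu>}"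

text \<open>Only the values of \<open>\<Phi>\<close> on \<open>G\<close> matter.\<close>

definition group_action ::
    "'n::finite cmat set \<Rightarrow> ('n cmat \<Rightarrow> 'a::banach \<Rightarrow> 'a) \<Rightarrow> bool" where
  "group_action G \<Phi> \<longleftrightarrow>
     \<Phi> (mat 1) = id \<and> (\<forall>g\<in>G. \<forall>h\<in>G. \<Phi> (g ** h) = \<Phi> g \<circ> \<Phi> h) \<and>
     (\<forall>u. continuous_on G (\<lambda>g. \<Phi> g u)) \<and> (\<forall>g\<in>G. continuous_on UNIV (\<Phi> g))"

text \<open>\<open>F\<close> is the family of Hamiltonians \<open>F \<xi>\<close>, indexed by the Lie algebra (values elsewhere
  are irrelevant).\<close>

definition globally_hamiltonian_action ::
    "'a::banach set \<Rightarrow> ('a \<Rightarrow>\<^sub>L ('a \<Rightarrow>\<^sub>L real)) \<Rightarrow> 'n::finite cmat set \<Rightarrow>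
     ('n cmat \<Rightarrow> 'a \<Rightarrow> 'a) \<Rightarrow> ('n cmat \<Rightarrow> 'a \<Rightarrow> real) \<Rightarrow> bool" where
  "globally_hamiltonian_action D J G \<Phi> F \<longleftrightarrow>
     group_action G \<Phi> \<and>
     (\<forall>g\<in>G. C1_on UNIV (\<Phi> g) \<and> symplectic_map D J (\<Phi> g) \<and> \<Phi> g ` D = D) \<and>
     (\<forall>\<xi>\<in>lie_algebra G. C1_on UNIV (F \<xi>) \<and> F \<xi> \<in> Dif D J \<and>
        hamiltonian_flow D J (F \<xi>) (\<lambda>t. \<Phi> (mexp (t *\<^sub>R \<xi>)))) \<and>
     (\<forall>\<xi>\<in>lie_algebra G. \<forall>\<eta>\<in>lie_algebra G. \<forall>a b :: real. \<forall>u.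
        F (a *\<^sub>R \<xi> + b *\<^sub>R \<eta>) u = a * F \<xi> u + b * F \<eta> u)"

definition momentum_map ::
    "nat \<Rightarrow> (nat \<Rightarrow> 'n::finite cmat) \<Rightarrow> ('n cmat \<Rightarrow> 'a::banach \<Rightarrow> real) \<Rightarrow> 'a \<Rightarrow> (nat \<Rightarrow> real)" where
  "momentum_map m e F u = (\<lambda>i\<in>{..<m}. F (e i) u)"

text \<open>The derivative at \<open>u\<close> of the \<open>\<real>\<^sup>m\<close>-valued momentum map, taken componentwise.\<close>

definition D_momentum ::
    "nat \<Rightarrow> (nat \<Rightarrow> 'n::finite cmat) \<Rightarrow> ('n cmat \<Rightarrow> 'a::banach \<Rightarrow> real) \<Rightarrow> 'a \<Rightarrow> 'a \<Rightarrow> (nat \<Rightarrow> real)" where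
  "D_momentum m e F u v = (\<lambda>i\<in>{..<m}. D_at (F (e i)) u v)"

text \<open>This is \<open>\<xi> \<cdot> D\<^sub>uF\<close>, with \<open>\<xi>\<close> expressed in the basis \<open>e\<close>.\<close>

definition dot_D_momentum ::
    "nat \<Rightarrow> (nat \<Rightarrow> 'n::finite cmat) \<Rightarrow> ('n cmat \<Rightarrow> 'a::banach \<Rightarrow> real) \<Rightarrow> 'n cmat \<Rightarrow> 'a \<Rightarrow> 'a \<Rightarrow>\<^sub>L real" where
  "dot_D_momentum m e F \<xi> u = (\<Sum>i<m. coord m e \<xi> i *\<^sub>R D_at (F (e i)) u)"

definition Ad_star_equivariant ::
    "'n::finite cmat set \<Rightarrow> ('n cmat \<Rightarrow> 'a::banach \<Rightarrow> 'a) \<Rightarrow> nat \<Rightarrow> (nat \<Rightarrow> 'n cmat) \<Rightarrow>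
     ('n cmat \<Rightarrow> 'a \<Rightarrow> real) \<Rightarrow> bool" where
  "Ad_star_equivariant G \<Phi> m e F \<longleftrightarrow>
     (\<forall>g\<in>G. momentum_map m e F \<circ> \<Phi> g = Ad_star m e g \<circ> momentum_map m e F)"

definition level_set ::
    "nat \<Rightarrow> (nat \<Rightarrow> 'n::finite cmat) \<Rightarrow> ('n cmat \<Rightarrow> 'a::banach \<Rightarrow> real) \<Rightarrow> (nat \<Rightarrow> real) \<Rightarrow> 'a set" where
  "level_set m e F \<mu> = {u. momentum_map m e F u = \<mu>}"

definition regular_value ::
    "nat \<Rightarrow> (nat \<Rightarrow> 'n::finite cmat) \<Rightarrow> ('n cmat \<Rightarrow> 'a::banach \<Rightarrow> real) \<Rightarrow> (nat \<Rightarrow> real) \<Rightarrow> bool" where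
  "regular_value m e F \<mu> \<longleftrightarrow> level_set m e F \<mu> \<noteq> {} \<and>
     (\<forall>u\<in>level_set m e F \<mu>. range (D_momentum m e F u) = {..<m} \<rightarrow>\<^sub>E UNIV)"

text \<open>The level set of a regular value is a submanifold whose tangent space at \<open>u\<close> is the kernel
  of the derivative of the momentum map; the definition is only used in that case.\<close>

definition tangent_level ::
    "nat \<Rightarrow> (nat \<Rightarrow> 'n::finite cmat) \<Rightarrow> ('n cmat \<Rightarrow> 'a::banach \<Rightarrow> real) \<Rightarrow> 'a \<Rightarrow> 'a set" where
  "tangent_level m e F u = {v. \<forall>i<m. D_momentum m e F u v i = 0}"

definition critical_point_on_level ::
    "nat \<Rightarrow> (nat \<Rightarrow> 'n::finite cmat) \<Rightarrow> ('n cmat \<Rightarrow> 'a::banach \<Rightarrow> real) \<Rightarrow> ('a \<Rightarrow> real) \<Rightarrow>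
     (nat \<Rightarrow> real) \<Rightarrow> 'a \<Rightarrow> bool" where
  "critical_point_on_level m e F H \<mu> u \<longleftrightarrow>
     u \<in> level_set m e F \<mu> \<and> (\<forall>v\<in>tangent_level m e F u. D_at H u v = 0)"

definition relative_equilibrium ::
    "(real \<Rightarrow> 'a \<Rightarrow> 'a) \<Rightarrow> ('n cmat \<Rightarrow> 'a \<Rightarrow> 'a) \<Rightarrow> 'n::finite cmat set \<Rightarrow> 'a::banach \<Rightarrow> bool" where
  "relative_equilibrium \<phi> \<Phi> G u \<longleftrightarrow> (\<forall>t. \<phi> t u \<in> {\<Phi> g u | g. g \<in> G})"

end

(* Noether's theorem in a Banach setting. The solution of an invariant Hamiltonian is carried by a
   symplectic diffeomorphism to a solution, so uniqueness and density of the domain give (i). The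
   same uniqueness gives (4) ==> (3): on the orbit of u under exp (t xi) both H and F xi are
   invariant, so the identity of their derivatives at u propagates along this orbit, which is then a
   solution for H. The momentum map is constant along both flows; together with equivariance this
   places every group element that moves u within its H-orbit, and hence every exp (t xi) in
   (5), in the isotropy group of mu. Statement (6) is the Lagrange multiplier rule for
   finitely many linearly independent functionals. *)

theory Submission
  imports Defs
begin

subsection \<open>Derivatives\<close>

lemma has_derivative_D_at:
  assumes "f differentiable (at u)"
  shows "(f has_derivative blinfun_apply (D_at f u)) (at u)"
proof -
  have d: "(f has_derivative frechet_derivative f (at u)) (at u)"
    using assms by (simp add: frechet_derivative_works)
  then have "bounded_linear (frechet_derivative f (at u))"
    by (rule has_derivative_bounded_linear)
  with d show ?thesis
    by (simp add: D_at_def bounded_linear_Blinfun_apply)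
qed

lemma D_at_eqI:
  assumes "(f has_derivative blinfun_apply A) (at u)"
  shows "D_at f u = A"
  by (simp add: D_at_def blinfun_apply_inverse flip: frechet_derivative_at[OF assms])

lemma D_at_comp:
  assumes "f differentiable (at v)" "K differentiable (at (f v))"
  shows "D_at (K \<circ> f) v w = D_at K (f v) (D_at f v w)"
proof -
  have "(K \<circ> f has_derivative blinfun_apply (D_at K (f v) o\<^sub>L D_at f v)) (at v)"
    using diff_chain_at[OF has_derivative_D_at[OF assms(1)] has_derivative_D_at[OF assms(2)]]
    by (simp add: blinfun_compose.rep_eq)
  then show ?thesis
    by (simp add: D_at_eqI)
qed

lemma has_vector_derivative_D_at_comp:
  assumes "(c has_vector_derivative c') (at t)" "K differentiable (at (c t))"
  shows "((\<lambda>s. K (c s)) has_vector_derivative D_at K (c t) c') (at t)"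
  using vector_derivative_diff_chain_within[of c c' t UNIV K "blinfun_apply (D_at K (c t))"]
    assms has_derivative_at_withinI[OF has_derivative_D_at[OF assms(2)]]
  by (simp add: comp_def)

text \<open>The chain rule for \<open>f \<circ> g = id\<close> exhibits \<open>D_at g (f v)\<close>
  as a right inverse of \<open>D_at f v\<close>. Test vectors at \<open>f v\<close> can then be
  written as \<open>D_at f v w\<close>, the form to which symplecticity and invariance
  apply.\<close>

lemma surj_D_at:
  assumes "f \<circ> g = id" "g \<circ> f = id" "f differentiable (at v)" "g differentiable (at (f v))"
  shows "surj (blinfun_apply (D_at f v))"
proof (rule surjI)
  fix w
  have gf: "g (f v) = v"
    using assms(2) by (metis comp_apply id_apply)
  have "(id has_derivative blinfun_apply id_blinfun) (at (f v))"
    by (simp add: has_derivative_id id_def)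
  then have "D_at (f \<circ> g) (f v) = id_blinfun"
    unfolding assms(1) by (rule D_at_eqI)
  then show "D_at f v (D_at g (f v) w) = w"
    using D_at_comp[of g "f v" f w] assms(3,4) by (simp add: gf)
qed

text \<open>The set where two continuous maps into a Hausdorff space agree is closed. This carries
  identities from the domain, where the flow solves an equation, to the whole space.\<close>

lemma eq_on_dense:
  fixes f g :: "'a::topological_space \<Rightarrow> 'b::t2_space"
  assumes "closure D = UNIV" "continuous_on UNIV f" "continuous_on UNIV g"
    and "\<And>x. x \<in> D \<Longrightarrow> f x = g x"
  shows "f = g"
proof -
  have "closure D \<subseteq> {x. f x = g x}"
    using assms by (intro closure_minimal closed_Collect_eq) auto
  with assms(1) show ?thesis
    by auto
qed

lemma C1_on_differentiable: "C1_on S f \<Longrightarrow> u \<in> S \<Longrightarrow> f differentiable (at u)"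
  by (simp add: C1_on_def)

lemma C1_on_UNIV_continuous: "C1_on UNIV f \<Longrightarrow> continuous_on UNIV f"
  by (metis C1_on_differentiable differentiable_at_withinI differentiable_imp_continuous_on
      differentiable_on_def UNIV_I)

subsection \<open>Hamiltonian flows\<close>

lemma hamiltonian_flow_in_domain:
  "hamiltonian_flow D J A \<phi> \<Longrightarrow> u \<in> D \<Longrightarrow> \<phi> t u \<in> D"
  unfolding hamiltonian_flow_def by blast

lemma hamiltonian_flow_zero: "hamiltonian_flow D J A \<phi> \<Longrightarrow> \<phi> 0 u = u"
  by (simp add: hamiltonian_flow_def)

lemma hamiltonian_flow_inverse:
  assumes "hamiltonian_flow D J A \<phi>"
  shows "\<phi> t \<circ> \<phi> (- t) = id"
proof -
  have "\<phi> (t + - t) = \<phi> t \<circ> \<phi> (- t)"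
    using assms unfolding hamiltonian_flow_def by blast
  then show ?thesis
    using assms by (simp add: hamiltonian_flow_def)
qed

lemma hamiltonian_flow_continuous: "hamiltonian_flow D J A \<phi> \<Longrightarrow> continuous_on UNIV (\<phi> t)"
  by (simp add: hamiltonian_flow_def)

lemma hamiltonian_flow_derivative:
  assumes "hamiltonian_flow D J A \<phi>" "u \<in> D"
  obtains c' where "((\<lambda>t. \<phi> t u) has_vector_derivative c') (at t)" "J c' = D_at A (\<phi> t u)"
  using assms unfolding hamiltonian_flow_def hamiltonian_solution_def by blast

lemma hamiltonian_flow_unique:
  assumes "hamiltonian_flow D J A \<phi>" "hamiltonian_solution D J A c" "c 0 \<in> D"
  shows "c t = \<phi> t (c 0)"
proof -
  have "c = (\<lambda>t. \<phi> t (c 0))"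
    using assms unfolding hamiltonian_flow_def by blast
  then show ?thesis
    by (rule fun_cong)
qed

section \<open>Conservation laws\<close>

lemma conserved_quantity:
  fixes B :: "'a::banach \<Rightarrow> real"
  assumes dense: "closure D = UNIV" and flow: "hamiltonian_flow D J A \<phi>"
    and B: "C1_on UNIV B"
    and zero: "\<And>v x. v \<in> D \<Longrightarrow> J x = D_at A v \<Longrightarrow> D_at B v x = 0"
  shows "B \<circ> \<phi> t = B"
proof (rule eq_on_dense[OF dense])
  note Bcont = C1_on_UNIV_continuous[OF B]
  show "continuous_on UNIV (B \<circ> \<phi> t)"
    using hamiltonian_flow_continuous[OF flow] continuous_on_subset[OF Bcont]
    by (intro continuous_on_compose) auto
  show "continuous_on UNIV B"
    by (fact Bcont)
  fix u assume u: "u \<in> D"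
  have "((\<lambda>s. B (\<phi> s u)) has_vector_derivative 0) (at s)" for s
  proof -
    obtain c' where c': "((\<lambda>t. \<phi> t u) has_vector_derivative c') (at s)" "J c' = D_at A (\<phi> s u)"
      using hamiltonian_flow_derivative[OF flow u] .
    have "((\<lambda>s. B (\<phi> s u)) has_vector_derivative D_at B (\<phi> s u) c') (at s)"
      using has_vector_derivative_D_at_comp[OF c'(1) C1_on_differentiable[OF B UNIV_I]] .
    \<comment> \<open>The velocity \<open>c'\<close> is a \<open>J\<close>-preimage of the
      derivative of \<open>A\<close>, so \<open>zero\<close> applies; that hypothesis is the
      vanishing of the Poisson bracket of \<open>B\<close> and \<open>A\<close>, phrased through
      preimages instead of an inverse of \<open>J\<close>.\<close>
    moreover have "D_at B (\<phi> s u) c' = 0"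
      using zero hamiltonian_flow_in_domain[OF flow u] c'(2) by blast
    ultimately show ?thesis by simp
  qed
  then have "\<forall>s. ((\<lambda>s. B (\<phi> s u)) has_real_derivative 0) (at s)"
    by (simp add: has_real_derivative_iff_has_vector_derivative)
  then have "B (\<phi> t u) = B (\<phi> 0 u)"
    by (rule DERIV_isconst_all)
  then show "(B \<circ> \<phi> t) u = B u"
    by (simp add: hamiltonian_flow_zero[OF flow])
qed

text \<open>Antisymmetry makes \<open>J x x\<close> vanish, so the derivative of \<open>A\<close>
  kills its own Hamiltonian vector.\<close>

lemma energy_conserved:
  assumes "closure D = UNIV" "symplector J" "hamiltonian_flow D J A \<phi>" "C1_on UNIV A"
  shows "A \<circ> \<phi> t = A"
proof (rule conserved_quantity[OF assms(1,3,4)])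
  fix v x assume "J x = D_at A v"
  moreover have "J x x = - J x x"
    using assms(2) unfolding symplector_def by blast
  ultimately show "D_at A v x = 0" by simp
qed

text \<open>With \<open>J x = D_at A v\<close> and \<open>J y = D_at B v\<close>, antisymmetry gives
  \<open>D_at B v x = - D_at A v y\<close>. The right side is minus the rate of change of
  \<open>A\<close> along \<open>\<psi>\<close> at time 0, which is zero by
  \<open>inv\<close>.\<close>

lemma noether:
  assumes "closure D = UNIV" "symplector J" "hamiltonian_flow D J A \<phi>" "C1_on UNIV A"
    and flowB: "hamiltonian_flow D J B \<psi>" and "C1_on UNIV B"
    and inv: "\<And>t. A \<circ> \<psi> t = A"
  shows "B \<circ> \<phi> t = B"
proof (rule conserved_quantity[OF assms(1,3,6)])
  fix v x assume v: "v \<in> D" and x: "J x = D_at A v"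
  obtain y where y: "((\<lambda>t. \<psi> t v) has_vector_derivative y) (at 0)" "J y = D_at B (\<psi> 0 v)"
    using hamiltonian_flow_derivative[OF flowB v] .
  have "((\<lambda>s. A (\<psi> s v)) has_vector_derivative D_at A (\<psi> 0 v) y) (at 0)"
    using has_vector_derivative_D_at_comp[OF y(1) C1_on_differentiable[OF assms(4) UNIV_I]] .
  moreover have "(\<lambda>s. A (\<psi> s v)) = (\<lambda>s. A v)"
    using inv by (metis comp_apply)
  ultimately have "D_at A v y = 0"
    using vector_derivative_unique_at has_vector_derivative_const
    by (metis hamiltonian_flow_zero[OF flowB])
  moreover have "J y x = - J x y"
    using assms(2) unfolding symplector_def by blast
  ultimately show "D_at B v x = 0"
    using x y(2) by (simp add: hamiltonian_flow_zero[OF flowB])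
qed

section \<open>Transport of solutions by symmetries, and common orbits\<close>

lemma symplectic_invariance_commute:
  assumes dense: "closure D = UNIV" and flow: "hamiltonian_flow D J A \<phi>" and A: "C1_on UNIV A"
    and f: "C1_on UNIV f" "symplectic_map D J f" "f ` D = D"
    and g: "C1_on UNIV g" "f \<circ> g = id" "g \<circ> f = id"
    and inv: "A \<circ> f = A"
  shows "f \<circ> \<phi> t = \<phi> t \<circ> f"
proof (rule eq_on_dense[OF dense])
  note cont = C1_on_UNIV_continuous[OF f(1)] hamiltonian_flow_continuous[OF flow]
  show "continuous_on UNIV (f \<circ> \<phi> t)" "continuous_on UNIV (\<phi> t \<circ> f)"
    using cont by (blast intro: continuous_on_compose continuous_on_subset)+
  fix u assume u: "u \<in> D"
  have "hamiltonian_solution D J A (\<lambda>t. f (\<phi> t u))"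
    unfolding hamiltonian_solution_def
  proof (intro allI conjI)
    fix t
    let ?v = "\<phi> t u"
    have v: "?v \<in> D"
      using hamiltonian_flow_in_domain[OF flow u] .
    then show "f ?v \<in> D"
      using f(3) by blast
    obtain c' where c': "((\<lambda>t. \<phi> t u) has_vector_derivative c') (at t)" "J c' = D_at A ?v"
      using hamiltonian_flow_derivative[OF flow u] .
    \<comment> \<open>The functionals are compared on vectors \<open>D_at f ?v w\<close>; these are
      all vectors because \<open>f\<close> has the differentiable inverse \<open>g\<close>.
      Symplecticity removes the derivative of \<open>f\<close> on the left, and the chain rule for
      \<open>A \<circ> f = A\<close> brings it back on the right.\<close>
    have "J (D_at f ?v c') = D_at A (f ?v)"
    proof (rule blinfun_eqI)
      fix x
      obtain w where w: "x = D_at f ?v w"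
        using surj_D_at[OF g(2,3)] C1_on_differentiable[OF f(1)] C1_on_differentiable[OF g(1)]
        by (metis UNIV_I surjD)
      have "J (D_at f ?v c') x = J c' w"
        using f(2) v w unfolding symplectic_map_def by blast
      also have "\<dots> = D_at (A \<circ> f) ?v w"
        by (simp add: c'(2) inv)
      also have "\<dots> = D_at A (f ?v) x"
        using D_at_comp[of f ?v A w] C1_on_differentiable[OF f(1)] C1_on_differentiable[OF A] w
        by simp
      finally show "J (D_at f ?v c') x = D_at A (f ?v) x" .
    qed
    moreover have "((\<lambda>t. f (\<phi> t u)) has_vector_derivative D_at f ?v c') (at t)"
      using has_vector_derivative_D_at_comp[OF c'(1) C1_on_differentiable[OF f(1) UNIV_I]] .
    ultimately show "\<exists>c'. ((\<lambda>t. f (\<phi> t u)) has_vector_derivative c') (at t) \<and>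
        J c' = D_at A (f ?v)" by blast
  qed
  then have "f (\<phi> t u) = \<phi> t (f (\<phi> 0 u))"
    using hamiltonian_flow_unique[OF flow] u f(3) hamiltonian_flow_zero[OF flow] by fastforce
  then show "(f \<circ> \<phi> t) u = (\<phi> t \<circ> f) u"
    by (simp add: hamiltonian_flow_zero[OF flow])
qed

text \<open>Used with \<open>H\<close> and \<open>F \<xi>\<close> to pass from a multiplier to an
  orbit. The \<open>\<psi>\<close>-curve solves the equation for \<open>B\<close>; once the
  derivatives of \<open>A\<close> and \<open>B\<close> agree along it, it solves the equation for
  \<open>A\<close> too, and uniqueness applies.\<close>

lemma common_orbit:
  assumes dense: "closure D = UNIV" and J: "symplector J"
    and flowA: "hamiltonian_flow D J A \<phi>" and A: "C1_on UNIV A"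
    and flowB: "hamiltonian_flow D J B \<psi>" and B: "C1_on UNIV B"
    and \<psi>: "\<And>t. C1_on UNIV (\<psi> t)" and inv: "\<And>t. A \<circ> \<psi> t = A"
    and u: "u \<in> D" and eq: "D_at A u = D_at B u"
  shows "\<phi> t u = \<psi> t u"
proof -
  have "D_at A (\<psi> t u) = D_at B (\<psi> t u)" for t
  proof (rule blinfun_eqI)
    fix x
    have "\<psi> (- t) \<circ> \<psi> t = id"
      using hamiltonian_flow_inverse[OF flowB, of "- t"] by simp
    then obtain w where w: "x = D_at (\<psi> t) u w"
      using surj_D_at[OF hamiltonian_flow_inverse[OF flowB]] C1_on_differentiable[OF \<psi>]
      by (metis UNIV_I surjD)
    \<comment> \<open>Differentiating \<open>K \<circ> \<psi> t = K\<close> at \<open>u\<close>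
      pulls the derivative back to \<open>u\<close>, where \<open>eq\<close> applies. For
      \<open>A\<close> the invariance is \<open>inv\<close>; for \<open>B\<close> it is conservation
      of energy along its own flow.\<close>
    have "D_at K (\<psi> t u) x = D_at K u w" if "C1_on UNIV K" "K \<circ> \<psi> t = K" for K :: "'a \<Rightarrow> real"
      using D_at_comp[of "\<psi> t" u K w] C1_on_differentiable[OF \<psi>] C1_on_differentiable[OF that(1)]
        that(2) w by simp
    then show "D_at A (\<psi> t u) x = D_at B (\<psi> t u) x"
      using A B inv energy_conserved[OF dense J flowB B] eq by simp
  qed
  moreover have "hamiltonian_solution D J B (\<lambda>t. \<psi> t u)"
    using flowB u unfolding hamiltonian_flow_def by blast
  ultimately have "hamiltonian_solution D J A (\<lambda>t. \<psi> t u)"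
    by (simp add: hamiltonian_solution_def)
  then show ?thesis
    using hamiltonian_flow_unique[OF flowA, of "\<lambda>t. \<psi> t u"] u hamiltonian_flow_zero[OF flowB]
    by simp
qed

text \<open>Equal orbits have the same velocity at time 0, and \<open>J\<close> sends it to both
  derivatives. This is the direction opposite to \<open>common_orbit\<close>.\<close>

lemma orbit_eq_imp_D_at_eq:
  assumes "hamiltonian_flow D J A \<phi>" "hamiltonian_flow D J B \<psi>" "u \<in> D"
    and "\<And>t. \<phi> t u = \<psi> t u"
  shows "D_at A u = D_at B u"
proof -
  obtain a where a: "((\<lambda>t. \<phi> t u) has_vector_derivative a) (at 0)" "J a = D_at A (\<phi> 0 u)"
    using hamiltonian_flow_derivative[OF assms(1,3)] .
  obtain b where b: "((\<lambda>t. \<psi> t u) has_vector_derivative b) (at 0)" "J b = D_at B (\<psi> 0 u)"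
    using hamiltonian_flow_derivative[OF assms(2,3)] .
  have "a = b"
    using vector_derivative_unique_at[OF a(1)] b(1) assms(4) by simp
  then show ?thesis
    using a(2) b(2) by (simp add: hamiltonian_flow_zero[OF assms(1)] hamiltonian_flow_zero[OF assms(2)])
qed

subsection \<open>Coordinates on the Lie algebra\<close>

text \<open>Partial sums are covered because the induction in \<open>hamiltonian_expansion\<close>
  must stay inside the Lie algebra to use linearity there.\<close>

lemma lie_basis_mem:
  assumes "lie_basis G m e" "k \<le> m"
  shows "(\<Sum>i<k. a i *\<^sub>R e i) \<in> lie_algebra G"
proof -
  have "(\<Sum>i<k. a i *\<^sub>R e i) \<in> span (e ` {..<m})"
    using assms(2) by (intro span_sum span_scale span_base) auto
  then show ?thesis
    using assms(1) by (simp add: lie_basis_def)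
qed

lemma coord_expansion:
  assumes "lie_basis G m e" "\<xi> \<in> lie_algebra G"
  shows "(\<Sum>i<m. coord m e \<xi> i *\<^sub>R e i) = \<xi>"
proof -
  have e: "inj_on e {..<m}" "independent (e ` {..<m})" "\<xi> \<in> span (e ` {..<m})"
    using assms by (auto simp: lie_basis_def)
  have "(\<Sum>b\<in>e ` {..<m}. representation (e ` {..<m}) \<xi> b *\<^sub>R b) = \<xi>"
    using e by (intro sum_representation_eq) auto
  then show ?thesis
    by (simp add: sum.reindex[OF e(1)] coord_def)
qed

lemma coord_sum:
  assumes "lie_basis G m e" "j < m"
  shows "coord m e (\<Sum>i<m. a i *\<^sub>R e i) j = a j"
proof -
  let ?B = "e ` {..<m}"
  have e: "inj_on e {..<m}" "independent ?B"
    using assms by (auto simp: lie_basis_def)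
  have "representation ?B (\<Sum>i<m. a i *\<^sub>R e i) = (\<lambda>b. \<Sum>i<m. representation ?B (a i *\<^sub>R e i) b)"
    using e by (intro representation_sum) (auto intro: span_scale span_base)
  also have "\<dots> = (\<lambda>b. \<Sum>i<m. a i * (if e i = b then 1 else 0))"
    using e by (intro ext sum.cong) (auto simp: representation_scale representation_basis span_base)
  finally have "coord m e (\<Sum>i<m. a i *\<^sub>R e i) j = (\<Sum>i<m. a i * (if e i = e j then 1 else 0))"
    by (simp add: coord_def)
  \<comment> \<open>Coordinates are attached to the vectors \<open>e i\<close>, so injectivity of
    \<open>e\<close> turns \<open>e i = e j\<close> into equality of indices.\<close>
  also have "\<dots> = (\<Sum>i<m. if i = j then a i else 0)"
    using assms(2) e(1) by (intro sum.cong) (auto dest: inj_onD)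
  finally show ?thesis
    using assms(2) by simp
qed

context
  fixes D :: "'a::banach set" and J :: "'a \<Rightarrow>\<^sub>L ('a \<Rightarrow>\<^sub>L real)" and G :: "'n::finite cmat set"
    and \<Phi> :: "'n cmat \<Rightarrow> 'a \<Rightarrow> 'a" and F :: "'n cmat \<Rightarrow> 'a \<Rightarrow> real"
    and m :: nat and e :: "nat \<Rightarrow> 'n cmat"
  assumes action: "globally_hamiltonian_action D J G \<Phi> F"
    and basis: "lie_basis G m e"
begin

lemma basis_mem: "i < m \<Longrightarrow> e i \<in> lie_algebra G"
  using basis by (metis imageI lessThan_iff lie_basis_def span_base)

lemma hamiltonian_C1: "\<xi> \<in> lie_algebra G \<Longrightarrow> C1_on UNIV (F \<xi>)"
  using action by (simp add: globally_hamiltonian_action_def)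

lemma hamiltonian_expansion:
  assumes "\<xi> \<in> lie_algebra G"
  shows "F \<xi> u = (\<Sum>i<m. coord m e \<xi> i * F (e i) u)"
proof -
  have lin: "F (a *\<^sub>R \<xi> + b *\<^sub>R \<eta>) u = a * F \<xi> u + b * F \<eta> u"
    if "\<xi> \<in> lie_algebra G" "\<eta> \<in> lie_algebra G" for \<xi> \<eta> a b
    using action that by (simp add: globally_hamiltonian_action_def)
  have "F (\<Sum>i<k. a i *\<^sub>R e i) u = (\<Sum>i<k. a i * F (e i) u)" if "k \<le> m" for k and a :: "nat \<Rightarrow> real"
    using that
  proof (induction k)
    \<comment> \<open>The empty sum is the zero matrix; linearity with both coefficients 0, at the
      available element \<open>\<xi>\<close>, gives \<open>F 0 u = 0\<close>.\<close>
    case 0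
    show ?case
      using lin[OF assms assms, of 0 0] by simp
  next
    case (Suc k)
    then show ?case
      using lin[OF lie_basis_mem[OF basis, of k a] basis_mem[of k], of 1 "a k"] by simp
  qed
  from this[of m "coord m e \<xi>"] show ?thesis
    by (simp add: coord_expansion[OF basis assms])
qed

text \<open>Differentiate the basis expansion of \<open>F \<xi>\<close>. The multiplier equation
  thereby becomes equality of the derivatives of the two Hamiltonians \<open>H\<close> and
  \<open>F \<xi>\<close>.\<close>

lemma D_at_hamiltonian:
  assumes "\<xi> \<in> lie_algebra G"
  shows "D_at (F \<xi>) u = dot_D_momentum m e F \<xi> u"
proof (rule D_at_eqI)
  have "((\<lambda>u. \<Sum>i<m. coord m e \<xi> i * F (e i) u) has_derivative
      (\<lambda>v. \<Sum>i<m. coord m e \<xi> i * D_at (F (e i)) u v)) (at u)"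
    using C1_on_differentiable[OF hamiltonian_C1[OF basis_mem]]
    by (intro has_derivative_sum has_derivative_mult_right has_derivative_D_at) auto
  moreover have "F \<xi> = (\<lambda>u. \<Sum>i<m. coord m e \<xi> i * F (e i) u)"
    using hamiltonian_expansion[OF assms] by blast
  ultimately show "(F \<xi> has_derivative blinfun_apply (dot_D_momentum m e F \<xi> u)) (at u)"
    by (simp add: dot_D_momentum_def blinfun.sum_left[abs_def] blinfun.scaleR_left)
qed

end

subsection \<open>The momentum map and Lagrange multipliers\<close>

text \<open>Noether's theorem for each component: \<open>F (e i)\<close> generates the one-parameter
  group of \<open>e i\<close>, which lies in \<open>G\<close> and so leaves \<open>H\<close>
  invariant.\<close>

lemma momentum_conserved:
  assumes "symplectic_banach_triple D J" "C1_on UNIV H" "hamiltonian_flow D J H \<phi>"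
    and basis: "lie_basis G m e" and action: "globally_hamiltonian_action D J G \<Phi> F"
    and inv: "\<forall>g\<in>G. H \<circ> \<Phi> g = H"
  shows "momentum_map m e F (\<phi> t u) = momentum_map m e F u"
proof -
  have "F (e i) (\<phi> t u) = F (e i) u" if "i < m" for i
  proof -
    note ei = basis_mem[OF action basis that]
    have "hamiltonian_flow D J (F (e i)) (\<lambda>t. \<Phi> (mexp (t *\<^sub>R e i)))"
      using action ei by (simp add: globally_hamiltonian_action_def)
    moreover have "H \<circ> \<Phi> (mexp (t *\<^sub>R e i)) = H" for t
      using inv ei by (simp add: lie_algebra_def)
    ultimately have "F (e i) \<circ> \<phi> t = F (e i)"
      using assms(1-3) hamiltonian_C1[OF action basis ei]
      by (intro noether) (auto simp: symplectic_banach_triple_def)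
    then show ?thesis
      by (metis comp_apply)
  qed
  then show ?thesis
    by (auto simp: momentum_map_def)
qed

text \<open>By equivariance the momentum of \<open>\<Phi> g u\<close> is the coadjoint image under
  \<open>g\<close> of the momentum of \<open>u\<close>; if it has not changed, \<open>g\<close>
  fixes it.\<close>

lemma momentum_preserving_in_isotropy:
  assumes "Ad_star_equivariant G \<Phi> m e F" "g \<in> G"
    and "momentum_map m e F (\<Phi> g u) = momentum_map m e F u"
  shows "g \<in> coadjoint_isotropy G m e (momentum_map m e F u)"
  using assms unfolding Ad_star_equivariant_def coadjoint_isotropy_def
  by (metis (mono_tags, lifting) comp_apply mem_Collect_eq)

section \<open>Lagrange multipliers at a regular value\<close>

lemma regular_value_dual_vectors:
  assumes "regular_value m e F (momentum_map m e F u)"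
  obtains w where "\<And>i j. i < m \<Longrightarrow> j < m \<Longrightarrow> D_at (F (e i)) u (w j) = (if i = j then 1 else 0)"
proof -
  have r: "range (D_momentum m e F u) = {..<m} \<rightarrow>\<^sub>E UNIV"
    using assms by (simp add: regular_value_def level_set_def)
  \<comment> \<open>The targets are the standard unit vectors in extensional form; for
    \<open>j \<ge> m\<close> the target is the zero vector, so \<open>w\<close> can be chosen for
    all \<open>j\<close> at once.\<close>
  have "\<exists>v. D_momentum m e F u v = (\<lambda>i\<in>{..<m}. if i = j then 1 else 0)" for j
  proof -
    have "(\<lambda>i\<in>{..<m}. if i = j then 1 else 0 :: real) \<in> range (D_momentum m e F u)"
      unfolding r by auto
    then show ?thesis
      by (metis imageE)
  qed
  then obtain w where w: "\<And>j. D_momentum m e F u (w j) = (\<lambda>i\<in>{..<m}. if i = j then 1 else 0)"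
    by metis
  have "D_at (F (e i)) u (w j) = (if i = j then 1 else 0)" if "i < m" for i j
    using fun_cong[OF w, of j i] that by (simp add: D_momentum_def)
  then show ?thesis
    using that by blast
qed

lemma dot_D_momentum_dual_vector:
  assumes "\<And>i j. i < m \<Longrightarrow> j < m \<Longrightarrow> D_at (F (e i)) u (w j) = (if i = j then 1 else 0)" "j < m"
  shows "dot_D_momentum m e F \<xi> u (w j) = coord m e \<xi> j"
proof -
  have "dot_D_momentum m e F \<xi> u (w j) = (\<Sum>i<m. if i = j then coord m e \<xi> i else 0)"
    unfolding dot_D_momentum_def blinfun.sum_left blinfun.scaleR_left
    using assms by (intro sum.cong) auto
  then show ?thesis
    using assms(2) by simp
qed

lemma lagrange_multiplier:
  assumes basis: "lie_basis G m e" and reg: "regular_value m e F (momentum_map m e F u)"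
  shows "(\<exists>\<xi>\<in>lie_algebra G. A = dot_D_momentum m e F \<xi> u) \<longleftrightarrow> (\<forall>v\<in>tangent_level m e F u. A v = 0)"
proof
  assume "\<exists>\<xi>\<in>lie_algebra G. A = dot_D_momentum m e F \<xi> u"
  then show "\<forall>v\<in>tangent_level m e F u. A v = 0"
    by (auto simp: dot_D_momentum_def tangent_level_def D_momentum_def
        blinfun.sum_left blinfun.scaleR_left)
next
  assume crit: "\<forall>v\<in>tangent_level m e F u. A v = 0"
  obtain w where w: "\<And>i j. i < m \<Longrightarrow> j < m \<Longrightarrow> D_at (F (e i)) u (w j) = (if i = j then 1 else 0)"
    using regular_value_dual_vectors[OF reg] by blast
  \<comment> \<open>Evaluation at the dual vectors \<open>w j\<close> reads off coordinates, so
    these coefficients are the only possible ones.\<close>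
  let ?\<xi> = "\<Sum>i<m. A (w i) *\<^sub>R e i"
  have "A v = dot_D_momentum m e F ?\<xi> u v" for v
  proof -
    \<comment> \<open>\<open>p\<close> is the projection of \<open>v\<close> to the span of the
      \<open>w j\<close> along the kernel of the momentum derivative; hence \<open>v - p\<close> is
      tangent and \<open>A v = A p\<close>.\<close>
    define p where "p = (\<Sum>j<m. D_at (F (e j)) u v *\<^sub>R w j)"
    have "D_at (F (e i)) u p = D_at (F (e i)) u v" if "i < m" for i
    proof -
      have "D_at (F (e i)) u p = (\<Sum>j<m. if i = j then D_at (F (e j)) u v else 0)"
        unfolding p_def blinfun.sum_right blinfun.scaleR_right
        using w that by (intro sum.cong) auto
      then show ?thesis
        using that by simp
    qed
    then have "v - p \<in> tangent_level m e F u"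
      by (simp add: tangent_level_def D_momentum_def blinfun.diff_right)
    with crit have "A (v - p) = 0"
      by blast
    then have "A v = A p"
      by (simp add: blinfun.diff_right)
    also have "\<dots> = dot_D_momentum m e F ?\<xi> u v"
      using coord_sum[OF basis]
      by (simp add: p_def dot_D_momentum_def blinfun.sum_right blinfun.sum_left
          blinfun.scaleR_right blinfun.scaleR_left mult.commute)
    finally show ?thesis .
  qed
  then have "A = dot_D_momentum m e F ?\<xi> u"
    by (rule blinfun_eqI)
  then show "\<exists>\<xi>\<in>lie_algebra G. A = dot_D_momentum m e F \<xi> u"
    using lie_basis_mem[OF basis order_refl] by (rule bexI)
qed

text \<open>Evaluating both functionals at the dual vectors recovers all coordinates of
  \<open>\<xi>\<close> and \<open>\<eta>\<close>.\<close>

lemma lagrange_multiplier_unique: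
  assumes basis: "lie_basis G m e" and reg: "regular_value m e F (momentum_map m e F u)"
    and "\<xi> \<in> lie_algebra G" "\<eta> \<in> lie_algebra G"
    and eq: "dot_D_momentum m e F \<xi> u = dot_D_momentum m e F \<eta> u"
  shows "\<xi> = \<eta>"
proof -
  obtain w where w: "\<And>i j. i < m \<Longrightarrow> j < m \<Longrightarrow> D_at (F (e i)) u (w j) = (if i = j then 1 else 0)"
    using regular_value_dual_vectors[OF reg] by blast
  have "coord m e \<xi> j = coord m e \<eta> j" if "j < m" for j
    using dot_D_momentum_dual_vector[of m F e u w j] w that eq by metis
  then have "(\<Sum>j<m. coord m e \<xi> j *\<^sub>R e j) = (\<Sum>j<m. coord m e \<eta> j *\<^sub>R e j)"
    by simp
  then show ?thesis
    by (simp add: coord_expansion[OF basis] assms(3,4))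
qed

section \<open>Commutation with the flow and the implications between the statements\<close>

theorem theorem7p1:
  fixes D :: "'a::banach set"
    and J :: "'a \<Rightarrow>\<^sub>L ('a \<Rightarrow>\<^sub>L real)"
    and H :: "'a \<Rightarrow> real"
    and \<Phi>H :: "real \<Rightarrow> 'a \<Rightarrow> 'a"
    and G :: "'n::finite cmat set"
    and m :: nat
    and e :: "nat \<Rightarrow> 'n cmat"
    and \<Phi> :: "'n cmat \<Rightarrow> 'a \<Rightarrow> 'a"
    and F :: "'n cmat \<Rightarrow> 'a \<Rightarrow> real"
  assumes triple: "symplectic_banach_triple D J"
    and H_C1: "C1_on UNIV H"
    and H_Dif: "H \<in> Dif D J"
    and H_flow: "hamiltonian_flow D J H \<Phi>H"
    and G_lie: "matrix_lie_group G"
    and basis: "lie_basis G m e"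
    and action: "globally_hamiltonian_action D J G \<Phi> F"
    and equivariant: "Ad_star_equivariant G \<Phi> m e F"
    and H_inv: "\<forall>g\<in>G. H \<circ> \<Phi> g = H"
  shows "(\<forall>g\<in>G. \<forall>t. \<Phi> g \<circ> \<Phi>H t = \<Phi>H t \<circ> \<Phi> g) \<and>
    (\<forall>u. let
        \<mu> = momentum_map m e F u;
        G\<mu> = coadjoint_isotropy G m e \<mu>;
        \<gg> = lie_algebra G;
        \<gg>\<mu> = lie_algebra G\<mu>;
        orbit = (\<lambda>\<xi>. \<forall>t. \<Phi>H t u = \<Phi> (mexp (t *\<^sub>R \<xi>)) u);
        multiplier = (\<lambda>\<xi>. D_at H u - dot_D_momentum m e F \<xi> u = 0);
        S1 = relative_equilibrium \<Phi>H \<Phi> G u;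
        S2 = relative_equilibrium \<Phi>H \<Phi> G\<mu> u;
        S3 = (\<exists>\<xi>\<in>\<gg>\<mu>. orbit \<xi>);
        S4 = (\<exists>\<xi>\<in>\<gg>\<mu>. multiplier \<xi>);
        S5 = (\<exists>\<xi>\<in>\<gg>. multiplier \<xi>);
        S6 = critical_point_on_level m e F H \<mu> u
      in (S1 \<longleftrightarrow> S2) \<and> (S3 \<longrightarrow> S2) \<and>
         (u \<in> D \<longrightarrow> (S3 \<longleftrightarrow> S4) \<and> (S4 \<longleftrightarrow> S5)) \<and>
         (u \<in> D \<and> regular_value m e F \<mu> \<longrightarrow>
            (S5 \<longleftrightarrow> S6) \<and>
            (\<exists>\<^sub>\<le>\<^sub>1\<xi>. (\<xi> \<in> \<gg>\<mu> \<and> orbit \<xi>) \<or> (\<xi> \<in> \<gg>\<mu> \<and> multiplier \<xi>) \<or> (\<xi> \<in> \<gg> \<and> multiplier \<xi>))))"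
proof -
  have dense: "closure D = UNIV" and J: "symplector J"
    using triple by (auto simp: symplectic_banach_triple_def)
  have act: "\<Phi> (mat 1) = id" "\<And>g h. g \<in> G \<Longrightarrow> h \<in> G \<Longrightarrow> \<Phi> (g ** h) = \<Phi> g \<circ> \<Phi> h"
    using action by (auto simp: globally_hamiltonian_action_def group_action_def)
  have smooth: "C1_on UNIV (\<Phi> g)" "symplectic_map D J (\<Phi> g)" "\<Phi> g ` D = D" if "g \<in> G" for g
    using action that by (auto simp: globally_hamiltonian_action_def)
  have flow: "hamiltonian_flow D J (F \<xi>) (\<lambda>t. \<Phi> (mexp (t *\<^sub>R \<xi>)))" if "\<xi> \<in> lie_algebra G" for \<xi>
    using action that by (simp add: globally_hamiltonian_action_def)
  note C1 = hamiltonian_C1[OF action basis]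
  note conserved = momentum_conserved[OF triple H_C1 H_flow basis action H_inv]

  have "\<Phi> g \<circ> \<Phi>H t = \<Phi>H t \<circ> \<Phi> g" if g: "g \<in> G" for g t
  proof -
    \<comment> \<open>Relative closedness of \<open>G\<close> includes containment in the invertible
      matrices; this makes the chosen \<open>matrix_inv g\<close> a genuine two-sided
      inverse.\<close>
    have "invertible g"
      using G_lie g closedin_imp_subset unfolding matrix_lie_group_def by blast
    then have inv: "g ** matrix_inv g = mat 1" "matrix_inv g ** g = mat 1"
      unfolding invertible_def matrix_inv_def by (metis (mono_tags, lifting) someI_ex)+
    have g': "matrix_inv g \<in> G"
      using G_lie g by (simp add: matrix_lie_group_def)
    have "\<Phi> g \<circ> \<Phi> (matrix_inv g) = id" "\<Phi> (matrix_inv g) \<circ> \<Phi> g = id"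
      using act(2)[OF g g'] act(2)[OF g' g] act(1) inv by simp_all
    then show ?thesis
      using symplectic_invariance_commute[OF dense H_flow H_C1 smooth[OF g] smooth(1)[OF g']] H_inv g
      by blast
  qed
  moreover
  {
    fix u
    define \<mu> where "\<mu> = momentum_map m e F u"
    define G\<mu> where "G\<mu> = coadjoint_isotropy G m e \<mu>"
    define orbit where "orbit = (\<lambda>\<xi>. \<forall>t. \<Phi>H t u = \<Phi> (mexp (t *\<^sub>R \<xi>)) u)"
    define multiplier where "multiplier = (\<lambda>\<xi>. D_at H u - dot_D_momentum m e F \<xi> u = 0)"
    note defs = \<mu>_def G\<mu>_def orbit_def multiplier_def
    have sub: "G\<mu> \<subseteq> G" "lie_algebra G\<mu> \<subseteq> lie_algebra G"
      by (auto simp: G\<mu>_def coadjoint_isotropy_def lie_algebra_def)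
    \<comment> \<open>\<open>g\<close> and the flow of \<open>H\<close> move \<open>u\<close> to the
      same point, where the momentum is still \<open>\<mu>\<close>; equivariance forces
      \<open>g\<close> to fix \<open>\<mu>\<close>. Both \<open>S12\<close> and \<open>S54\<close>
      rest on this.\<close>
    have isotropy: "g \<in> G\<mu>" if "g \<in> G" "\<Phi>H t u = \<Phi> g u" for g t
      using momentum_preserving_in_isotropy[OF equivariant that(1)] conserved[of t u] that(2)
      by (simp add: G\<mu>_def \<mu>_def)
    have S12: "relative_equilibrium \<Phi>H \<Phi> G u \<longleftrightarrow> relative_equilibrium \<Phi>H \<Phi> G\<mu> u"
      unfolding relative_equilibrium_def using isotropy sub(1) by blast
    have S32: "(\<exists>\<xi>\<in>lie_algebra G\<mu>. orbit \<xi>) \<longrightarrow> relative_equilibrium \<Phi>H \<Phi> G\<mu> u"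
      unfolding relative_equilibrium_def lie_algebra_def orbit_def by blast
    have mult_iff: "multiplier \<xi> \<longleftrightarrow> D_at H u = D_at (F \<xi>) u" if "\<xi> \<in> lie_algebra G" for \<xi>
      by (simp add: multiplier_def D_at_hamiltonian[OF action basis that])
    \<comment> \<open>Proved on the whole Lie algebra of \<open>G\<close>: restricted to that of
      \<open>G\<mu>\<close> it relates \<open>S3\<close> and \<open>S4\<close>, and in full it feeds
      \<open>S54\<close>.\<close>
    have S34: "orbit \<xi> \<longleftrightarrow> multiplier \<xi>" if "u \<in> D" and \<xi>: "\<xi> \<in> lie_algebra G" for \<xi>
    proof
      assume "orbit \<xi>"
      then show "multiplier \<xi>"
        using orbit_eq_imp_D_at_eq[OF H_flow flow[OF \<xi>] \<open>u \<in> D\<close>] mult_iff[OF \<xi>]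
        by (simp add: orbit_def)
    next
      assume "multiplier \<xi>"
      moreover have "mexp (t *\<^sub>R \<xi>) \<in> G" for t
        using \<xi> by (simp add: lie_algebra_def)
      ultimately show "orbit \<xi>"
        unfolding orbit_def
        using common_orbit[OF dense J H_flow H_C1 flow[OF \<xi>] C1[OF \<xi>] smooth(1) _ \<open>u \<in> D\<close>]
          mult_iff[OF \<xi>] H_inv by blast
    qed
    \<comment> \<open>By \<open>S34\<close> every \<open>mexp (t *\<^sub>R \<xi>)\<close> moves
      \<open>u\<close> within its \<open>H\<close>-orbit, so by \<open>isotropy\<close> all of them
      lie in \<open>G\<mu>\<close>, which is membership in its Lie algebra.\<close>
    have S54: "\<xi> \<in> lie_algebra G\<mu>" if "u \<in> D" "\<xi> \<in> lie_algebra G" "multiplier \<xi>" for \<xi>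
      using S34[OF that(1,2)] that isotropy by (auto simp: orbit_def lie_algebra_def)
    have S56: "(\<exists>\<xi>\<in>lie_algebra G. multiplier \<xi>) \<longleftrightarrow> critical_point_on_level m e F H \<mu> u"
      if "regular_value m e F \<mu>"
      using lagrange_multiplier[OF basis, of F u "D_at H u"] that
      by (simp add: multiplier_def critical_point_on_level_def level_set_def \<mu>_def)
    \<comment> \<open>The disjunction makes uniqueness hold across the statements: witnesses of
      \<open>S3\<close>, \<open>S4\<close> and \<open>S5\<close> coincide with each other.
      \<open>red\<close> reduces every case to the last disjunct.\<close>
    have unique: "\<exists>\<^sub>\<le>\<^sub>1\<xi>. (\<xi> \<in> lie_algebra G\<mu> \<and> orbit \<xi>) \<or> (\<xi> \<in> lie_algebra G\<mu> \<and> multiplier \<xi>)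
        \<or> (\<xi> \<in> lie_algebra G \<and> multiplier \<xi>)" if "u \<in> D" "regular_value m e F \<mu>"
    proof (rule Uniq_I)
      have red: "\<xi> \<in> lie_algebra G \<and> multiplier \<xi>"
        if "(\<xi> \<in> lie_algebra G\<mu> \<and> orbit \<xi>) \<or> (\<xi> \<in> lie_algebra G\<mu> \<and> multiplier \<xi>)
          \<or> (\<xi> \<in> lie_algebra G \<and> multiplier \<xi>)" for \<xi>
        using that sub(2) S34[OF \<open>u \<in> D\<close>] by blast
      fix \<xi> \<eta>
      assume "(\<xi> \<in> lie_algebra G\<mu> \<and> orbit \<xi>) \<or> (\<xi> \<in> lie_algebra G\<mu> \<and> multiplier \<xi>)
          \<or> (\<xi> \<in> lie_algebra G \<and> multiplier \<xi>)"
        and "(\<eta> \<in> lie_algebra G\<mu> \<and> orbit \<eta>) \<or> (\<eta> \<in> lie_algebra G\<mu> \<and> multiplier \<eta>)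
          \<or> (\<eta> \<in> lie_algebra G \<and> multiplier \<eta>)"
      then have "\<xi> \<in> lie_algebra G" "multiplier \<xi>" "\<eta> \<in> lie_algebra G" "multiplier \<eta>"
        using red by blast+
      then show "\<xi> = \<eta>"
        using lagrange_multiplier_unique[OF basis] that(2)
        by (simp add: multiplier_def \<mu>_def)
    qed
    have "(relative_equilibrium \<Phi>H \<Phi> G u \<longleftrightarrow> relative_equilibrium \<Phi>H \<Phi> G\<mu> u) \<and>
      ((\<exists>\<xi>\<in>lie_algebra G\<mu>. orbit \<xi>) \<longrightarrow> relative_equilibrium \<Phi>H \<Phi> G\<mu> u) \<and>
      (u \<in> D \<longrightarrow> ((\<exists>\<xi>\<in>lie_algebra G\<mu>. orbit \<xi>) \<longleftrightarrow> (\<exists>\<xi>\<in>lie_algebra G\<mu>. multiplier \<xi>)) \<and>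
         ((\<exists>\<xi>\<in>lie_algebra G\<mu>. multiplier \<xi>) \<longleftrightarrow> (\<exists>\<xi>\<in>lie_algebra G. multiplier \<xi>))) \<and>
      (u \<in> D \<and> regular_value m e F \<mu> \<longrightarrow>
         ((\<exists>\<xi>\<in>lie_algebra G. multiplier \<xi>) \<longleftrightarrow> critical_point_on_level m e F H \<mu> u) \<and>
         (\<exists>\<^sub>\<le>\<^sub>1\<xi>. (\<xi> \<in> lie_algebra G\<mu> \<and> orbit \<xi>) \<or> (\<xi> \<in> lie_algebra G\<mu> \<and> multiplier \<xi>)
           \<or> (\<xi> \<in> lie_algebra G \<and> multiplier \<xi>)))"
      using S12 S32 S34 S54 S56 unique sub(2) by (intro conjI impI) blast+
    note this[unfolded defs]
  }
  ultimately show ?thesis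
    unfolding Let_def by blast
qed

end
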